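(* For $n\geq1$, let $\alpha\in\mathbb C$, $K(h)\in\mathrm{GL}_n(\mathbb C[h])$, and let $\boldsymbol a=(a_-,a_0,a_+)\in\mathbb Z_{\geq0}^3$ satisfy $a_-+a_0+a_+=n$. Then $$M\big(\alpha,\boldsymbol a,K(h)\big)^{\vee_{\mathfrak h}}\simeq M\Big(\alpha,(a_+,-a_0,a_-),\,-\mathrm T_n\big(K(h)^{-1}\big)^{\mathsf T}\mathrm T_n\Big).$$
   Context: The Lie algebra $\mathfrak{sl}(2)$ over $\mathbb C$ has basis $e,f,h$ with $[h,e]=e$, $[h,f]=-f$, $[e,f]=2h$; $\mathfrak h=\mathbb Ch$, $U(\mathfrak h)=\mathbb C[h]$. The automorphism $\sigma$ of $\mathbb C[h]$ is $\sigma(g(h))=g(h-1)$, applied entrywise. For $E,F\in\mathrm{Mat}_n(\mathbb C[h])$ with $E\sigma(F)-F\sigma^{-1}(E)=2h\,\mathrm I_n$, $M(E,F)$ is the $\mathfrak{sl}(2)$-module on $\mathbb C[h]^{\oplus n}$ with $h$ acting by multiplication, $e\cdot\boldsymbol g=E\sigma(\boldsymbol g)$, $f\cdot\boldsymbol g=F\sigma^{-1}(\boldsymbol g)$. Put $\lambda_\alpha(h)=-(h-\alpha+1)(h+\alpha)$. For $\boldsymbol a=(a_-,a_0,a_+)\in\mathbb Z_{\geq0}\times\mathbb Z\times\mathbb Z_{\geq0}$ with $a_-+|a_0|+a_+=n$, $P_{(\boldsymbol a,\alpha)}(h)$ is the diagonal $n\times n$ matrix with diagonal entries: $1$ ($a_-$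 times), then $|a_0|$ entries equal to $h-\alpha+1$ if $a_0\geq0$ and to $h+\alpha$ if $a_0<0$, then $(h-\alpha+1)(h+\alpha)$ ($a_+$ times); $\overline P_{(\boldsymbol a,\alpha)}(h)$ is the diagonal matrix with $\overline P_{(\boldsymbol a,\alpha)}P_{(\boldsymbol a,\alpha)}=\lambda_\alpha(h)\mathrm I_n$. Set $M(\alpha,\boldsymbol a,K(h)):=M\big(\sigma(K^{-1}(h)\overline P_{(\boldsymbol a,\alpha)}(h)),P_{(\boldsymbol a,\alpha)}(h)K(h)\big)$. $\mathrm T_n$ is the $n\times n$ antidiagonal permutation matrix (ones on the antidiagonal, zeros elsewhere). For an $\mathfrak{sl}(2)$-module $M$ that is free of finite rank over $\mathbb C[h]$, its $U(\mathfrak h)$-dual is $M^{\vee_{\mathfrak h}}:=\mathrm{Hom}_{\mathbb C[h]}(M,\mathbb C[h])$ with $\mathfrak{sl}(2)$-action $(h\cdot g)(m)=h\,g(m)$, $(e\cdot g)(m)=\sigma(g(f\cdot m))$, $(f\cdot g)(m)=\sigma^{-1}(g(e\cdot m))$. *)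

theory Defs
  imports "Jordan_Normal_Form.VS_Connect"
begin

hide_const (open) Modules.module_hom

section \<open>The Lie algebra and its modules\<close>

text \<open>\<open>SL2 x y z\<close> is the element \<open>x e + y f + z h\<close>. The basis is normalised by
  \<open>[h,e] = e\<close>, \<open>[h,f] = -f\<close>, \<open>[e,f] = 2h\<close>, so \<open>h\<close> is half the usual semisimple element.\<close>

datatype sl2 = SL2 (coef_e: complex) (coef_f: complex) (coef_h: complex)

definition sl2_e :: sl2 where "sl2_e = SL2 1 0 0"
definition sl2_f :: sl2 where "sl2_f = SL2 0 1 0"
definition sl2_h :: sl2 where "sl2_h = SL2 0 0 1"

definition sl2_add :: "sl2 \<Rightarrow> sl2 \<Rightarrow> sl2" where
  "sl2_add x y = SL2 (coef_e x + coef_e y) (coef_f x + coef_f y) (coef_h x + coef_h y)"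

definition sl2_scale :: "complex \<Rightarrow> sl2 \<Rightarrow> sl2" where
  "sl2_scale c x = SL2 (c * coef_e x) (c * coef_f x) (c * coef_h x)"

definition sl2_bracket :: "sl2 \<Rightarrow> sl2 \<Rightarrow> sl2" where
  "sl2_bracket x y = SL2
     (coef_h x * coef_e y - coef_e x * coef_h y)
     (coef_f x * coef_h y - coef_h x * coef_f y)
     (2 * (coef_e x * coef_f y - coef_f x * coef_e y))"

lemma sl2_bracket_basis:
  "sl2_bracket sl2_h sl2_e = sl2_e"
  "sl2_bracket sl2_h sl2_f = sl2_scale (- 1) sl2_f"
  "sl2_bracket sl2_e sl2_f = sl2_scale 2 sl2_h"
  by (simp_all add: sl2_bracket_def sl2_scale_def sl2_e_def sl2_f_def sl2_h_def)

lemma sl2_bracket_self: "sl2_bracket x x = SL2 0 0 0"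
  by (simp add: sl2_bracket_def)

lemma sl2_jacobi:
  "sl2_add (sl2_bracket x (sl2_bracket y z))
     (sl2_add (sl2_bracket y (sl2_bracket z x)) (sl2_bracket z (sl2_bracket x y))) = SL2 0 0 0"
  by (simp add: sl2_bracket_def sl2_add_def algebra_simps)

record 'v sl2_mod = "(complex, 'v) module" +
  sl2_act :: "sl2 \<Rightarrow> 'v \<Rightarrow> 'v"

locale sl2_module = vectorspace "class_ring :: complex ring" V
  for V :: "'v sl2_mod" (structure) +
  assumes act_hom: "sl2_act V x \<in> module_hom (class_ring :: complex ring) V V"
    and act_add: "v \<in> carrier V \<Longrightarrow>
      sl2_act V (sl2_add x y) v = sl2_act V x v \<oplus>\<^bsub>V\<^esub> sl2_act V y v"
    and act_scale: "v \<in> carrier V \<Longrightarrow>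
      sl2_act V (sl2_scale c x) v = c \<odot>\<^bsub>V\<^esub> sl2_act V x v"
    and act_bracket: "v \<in> carrier V \<Longrightarrow>
      sl2_act V (sl2_bracket x y) v
        = sl2_act V x (sl2_act V y v) \<ominus>\<^bsub>V\<^esub> sl2_act V y (sl2_act V x v)"

text \<open>Isomorphism of modules; that both sides really are \<open>sl2\<close>-modules is part of the claim.\<close>

definition sl2_iso :: "'v sl2_mod \<Rightarrow> 'w sl2_mod \<Rightarrow> bool" (infix \<open>\<simeq>\<close> 50) where
  "V \<simeq> W \<longleftrightarrow> sl2_module V \<and> sl2_module W \<and>
     (\<exists>\<phi> \<in> module_hom (class_ring :: complex ring) V W.
        bij_betw \<phi> (carrier V) (carrier W) \<and>
        (\<forall>x. \<forall>v \<in> carrier V. \<phi> (sl2_act V x v) = sl2_act W x (\<phi> v)))"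

text \<open>Extends prescribed actions of \<open>e\<close>, \<open>f\<close>, \<open>h\<close> on a complex vector space linearly to all of
  the Lie algebra.\<close>

definition sl2_extend ::
    "(complex, 'v) module \<Rightarrow> ('v \<Rightarrow> 'v) \<Rightarrow> ('v \<Rightarrow> 'v) \<Rightarrow> ('v \<Rightarrow> 'v) \<Rightarrow> 'v sl2_mod" where
  "sl2_extend V act_e act_f act_h = \<lparr>
     carrier = carrier V, mult = mult V, one = one V, zero = zero V, add = add V,
     smult = smult V,
     sl2_act = (\<lambda>x v. coef_e x \<odot>\<^bsub>V\<^esub> act_e v \<oplus>\<^bsub>V\<^esub> coef_f x \<odot>\<^bsub>V\<^esub> act_f v
                       \<oplus>\<^bsub>V\<^esub> coef_h x \<odot>\<^bsub>V\<^esub> act_h v)\<rparr>"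

section \<open>Modules over \<open>U(\<hh>) = \<complex>[h]\<close>\<close>

abbreviation hvar :: "complex poly" where "hvar \<equiv> [:0, 1:]"

definition sigma :: "complex poly \<Rightarrow> complex poly" where
  "sigma g = pcompose g (hvar - 1)"

definition sigma_inv :: "complex poly \<Rightarrow> complex poly" where
  "sigma_inv g = pcompose g (hvar + 1)"

lemma sigma_sigma_inv: "sigma (sigma_inv g) = g" and sigma_inv_sigma: "sigma_inv (sigma g) = g"
  by (simp_all add: sigma_def sigma_inv_def one_pCons pcompose_pCons flip: pcompose_assoc)

definition mod_EF :: "nat \<Rightarrow> complex poly mat \<Rightarrow> complex poly mat \<Rightarrow> complex poly vec sl2_mod" where
  "mod_EF n E F = sl2_extend
     \<lparr>carrier = carrier_vec n, mult = undefined, one = undefined, zero = 0\<^sub>v n, add = (+),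
      smult = (\<lambda>c g. [:c:] \<cdot>\<^sub>v g)\<rparr>
     (\<lambda>g. E *\<^sub>v map_vec sigma g)
     (\<lambda>g. F *\<^sub>v map_vec sigma_inv g)
     (\<lambda>g. hvar \<cdot>\<^sub>v g)"

text \<open>The \<open>\<complex>[h]\<close>-module underlying an \<open>sl2\<close>-module: the variable acts as \<open>h\<close>.\<close>

definition Uh_module :: "'v sl2_mod \<Rightarrow> (complex poly, 'v) module" where
  "Uh_module V = \<lparr>
     carrier = carrier V, mult = mult V, one = one V, zero = zero V, add = add V,
     smult = (\<lambda>p v. \<Oplus>\<^bsub>V\<^esub>i\<in>{..degree p}. coeff p i \<odot>\<^bsub>V\<^esub> (sl2_act V sl2_h ^^ i) v)\<rparr>"

definition poly_module :: "(complex poly, complex poly) module" where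
  "poly_module = \<lparr>carrier = UNIV, mult = (*), one = 1, zero = 0, add = (+), smult = (*)\<rparr>"

text \<open>Homomorphisms are made extensional so that each has a unique representative as a
  HOL function.\<close>

definition Uh_dual :: "'v sl2_mod \<Rightarrow> ('v \<Rightarrow> complex poly) sl2_mod" where
  "Uh_dual V = sl2_extend
     \<lparr>carrier = module_hom (class_ring :: complex poly ring) (Uh_module V) poly_module
                  \<inter> extensional (carrier V),
      mult = undefined, one = undefined,
      zero = (\<lambda>m \<in> carrier V. 0),
      add = (\<lambda>g g'. \<lambda>m \<in> carrier V. g m + g' m),
      smult = (\<lambda>c g. \<lambda>m \<in> carrier V. [:c:] * g m)\<rparr>
     (\<lambda>g. \<lambda>m \<in> carrier V. sigma (g (sl2_act V sl2_f m)))
     (\<lambda>g. \<lambda>m \<in> carrier V. sigma_inv (g (sl2_act V sl2_e m)))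
     (\<lambda>g. \<lambda>m \<in> carrier V. hvar * g m)"

section \<open>The family \<open>M(\<alpha>, a, K)\<close>\<close>

abbreviation GL :: "nat \<Rightarrow> complex poly mat set" where
  "GL n \<equiv> Units (ring_mat TYPE(complex poly) n ())"

abbreviation GL_inv :: "nat \<Rightarrow> complex poly mat \<Rightarrow> complex poly mat" where
  "GL_inv n K \<equiv> inv\<^bsub>ring_mat TYPE(complex poly) n ()\<^esub> K"

definition lam :: "complex \<Rightarrow> complex poly" where
  "lam \<alpha> = - ((hvar - [:\<alpha>:] + 1) * (hvar + [:\<alpha>:]))"

definition P_entries :: "nat \<times> int \<times> nat \<Rightarrow> complex \<Rightarrow> complex poly list" where
  "P_entries = (\<lambda>(am, a0, ap) \<alpha>.
     replicate am 1
     @ replicate (nat \<bar>a0\<bar>) (if a0 \<ge> 0 then hvar - [:\<alpha>:] + 1 else hvar + [:\<alpha>:])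
     @ replicate ap ((hvar - [:\<alpha>:] + 1) * (hvar + [:\<alpha>:])))"

definition asize :: "nat \<times> int \<times> nat \<Rightarrow> nat" where
  "asize = (\<lambda>(am, a0, ap). am + nat \<bar>a0\<bar> + ap)"

definition P_mat :: "nat \<times> int \<times> nat \<Rightarrow> complex \<Rightarrow> complex poly mat" where
  "P_mat a \<alpha> = mat_diag (asize a) (\<lambda>i. P_entries a \<alpha> ! i)"

definition P_bar :: "nat \<times> int \<times> nat \<Rightarrow> complex \<Rightarrow> complex poly mat" where
  "P_bar a \<alpha> = (THE Q. Q \<in> carrier_mat (asize a) (asize a) \<and> diagonal_mat Q \<and>
     Q * P_mat a \<alpha> = lam \<alpha> \<cdot>\<^sub>m 1\<^sub>m (asize a))"

definition mod_alpha ::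
    "complex \<Rightarrow> nat \<times> int \<times> nat \<Rightarrow> complex poly mat \<Rightarrow> complex poly vec sl2_mod" where
  "mod_alpha \<alpha> a K = mod_EF (asize a)
     (map_mat sigma (GL_inv (asize a) K * P_bar a \<alpha>)) (P_mat a \<alpha> * K)"

definition antidiag :: "nat \<Rightarrow> complex poly mat" where
  "antidiag n = Matrix.mat n n (\<lambda>(i, j). if i + j + 1 = n then 1 else 0)"

lemma P_entries_length: "length (P_entries a \<alpha>) = asize a"
  by (cases a) (simp add: P_entries_def asize_def)

lemma P_entries_dvd_lam:
  assumes "i < asize a"
  shows "P_entries a \<alpha> ! i \<noteq> 0 \<and> P_entries a \<alpha> ! i dvd lam \<alpha>"
proof -
  have nz: "hvar - [:\<alpha>:] + 1 \<noteq> 0" "hvar + [:\<alpha>:] \<noteq> 0"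
    by (simp_all add: one_pCons)
  have "p \<noteq> 0 \<and> p dvd lam \<alpha>" if p: "p \<in> set (P_entries a \<alpha>)" for p
  proof -
    consider "p = 1" | "p = hvar - [:\<alpha>:] + 1" | "p = hvar + [:\<alpha>:]"
      | "p = (hvar - [:\<alpha>:] + 1) * (hvar + [:\<alpha>:])"
      using p by (cases a) (auto simp: P_entries_def simp del: mult_pCons_left mult_pCons_right
          split: if_splits)
    moreover have "q \<noteq> 0 \<and> q dvd u * v" if "u \<noteq> 0" "v \<noteq> 0" "q \<in> {1, u, v, u * v}"
      for q u v :: "complex poly"
      using that by auto
    ultimately show ?thesis
      using nz unfolding lam_def dvd_minus_iff by (metis insert_iff)
  qed
  then show ?thesis using assms by (metis P_entries_length nth_mem)
qed

text \<open>The description in \<^const>\<open>P_bar\<close> determines a matrix.\<close>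

lemma P_bar_ex1:
  "\<exists>!Q. Q \<in> carrier_mat (asize a) (asize a) \<and> diagonal_mat Q \<and>
     Q * P_mat a \<alpha> = lam \<alpha> \<cdot>\<^sub>m 1\<^sub>m (asize a)"
proof -
  let ?n = "asize a" and ?p = "\<lambda>i. P_entries a \<alpha> ! i"
  have mult: "Q * P_mat a \<alpha> = Matrix.mat ?n ?n (\<lambda>(i, j). Q $$ (i, j) * ?p j)"
    if "Q \<in> carrier_mat ?n ?n" for Q
    unfolding P_mat_def by (rule mat_diag_mult_right[OF that])
  show ?thesis
  proof (rule ex1I[of _ "mat_diag ?n (\<lambda>i. lam \<alpha> div ?p i)"], intro conjI)
    show "mat_diag ?n (\<lambda>i. lam \<alpha> div ?p i) * P_mat a \<alpha> = lam \<alpha> \<cdot>\<^sub>m 1\<^sub>m ?n"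
      using P_entries_dvd_lam[of _ a \<alpha>] by (subst mult) (auto simp: mat_diag_def intro!: eq_matI)
  next
    fix Q assume Q: "Q \<in> carrier_mat ?n ?n \<and> diagonal_mat Q \<and>
      Q * P_mat a \<alpha> = lam \<alpha> \<cdot>\<^sub>m 1\<^sub>m ?n"
    have "Q $$ (i, i) * ?p i = lam \<alpha>" if "i < ?n" for i
    proof -
      have "(Q * P_mat a \<alpha>) $$ (i, i) = lam \<alpha>" using Q that by simp
      moreover have "(Q * P_mat a \<alpha>) $$ (i, i) = Q $$ (i, i) * ?p i"
        using Q that by (subst mult) auto
      ultimately show ?thesis by simp
    qed
    then have "Q $$ (i, i) = lam \<alpha> div ?p i" if "i < ?n" for i
      using that P_entries_dvd_lam by (metis nonzero_mult_div_cancel_right)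
    then show "Q = mat_diag ?n (\<lambda>i. lam \<alpha> div ?p i)"
      using Q by (intro eq_matI) (auto simp: mat_diag_def diagonal_mat_def)
  qed (auto simp: mat_diag_def diagonal_mat_def)
qed

end

theory Submission
  imports Defs
begin

text \<open>A \<open>\<complex>[h]\<close>-linear functional on \<open>\<complex>[h]\<^sup>n\<close> is \<open>m \<mapsto> w\<^sup>T m\<close> for a unique vector \<open>w\<close>, and in the
  coordinate \<open>w\<close> the dual of \<open>M(E, F)\<close> is \<open>M(\<sigma>(F)\<^sup>T, \<sigma>\<^sup>-\<^sup>1(E)\<^sup>T)\<close>. For \<open>M(\<alpha>, a, K)\<close> these two
  matrices are \<open>\<sigma>(K\<^sup>T P)\<close> and \<open>Q (K\<^sup>-\<^sup>1)\<^sup>T\<close>, where \<open>P\<close> is the diagonal matrix of \<open>a\<close> and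
  \<open>Q P = \<lambda>\<close>. Reversing the order of the diagonal of \<open>Q\<close> gives, up to a sign, the diagonal
  matrix of \<open>(a\<^sub>+, - a\<^sub>0, a\<^sub>-)\<close>, so conjugation by \<open>T\<close> finishes the proof.\<close>

section \<open>Shifts of the variable, and matrix-vector identities\<close>

interpretation sigma: comm_ring_hom sigma
  by unfold_locales (simp_all add: sigma_def pcompose_add pcompose_mult pcompose_1)

interpretation sigma_inv: comm_ring_hom sigma_inv
  by unfold_locales (simp_all add: sigma_inv_def pcompose_add pcompose_mult pcompose_1)

lemma sigma_const [simp]: "sigma [:c:] = [:c:]" and sigma_inv_const [simp]: "sigma_inv [:c:] = [:c:]"
  by (simp_all add: sigma_def sigma_inv_def)

lemma sigma_hvar: "sigma hvar = hvar - 1" and sigma_inv_hvar: "sigma_inv hvar = hvar + 1"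
  by (simp_all add: sigma_def sigma_inv_def pcompose_pCons)

lemma map_vec_sigma_sigma_inv [simp]: "map_vec sigma (map_vec sigma_inv v) = v"
  and map_vec_sigma_inv_sigma [simp]: "map_vec sigma_inv (map_vec sigma v) = v"
  by (auto simp: sigma_sigma_inv sigma_inv_sigma)

lemma map_mat_sigma_inv_sigma [simp]: "map_mat sigma_inv (map_mat sigma A) = A"
  by (auto simp: sigma_inv_sigma)

lemma (in semiring_hom) hom_scalar_prod:
  assumes "dim_vec v = dim_vec w"
  shows "hom (v \<bullet> w) = map_vec hom v \<bullet> map_vec hom w"
proof -
  have "hom (\<Sum>i\<in>A. f i) = (\<Sum>i\<in>A. hom (f i))" if "finite A" for A and f :: "nat \<Rightarrow> 'a"
    using that by induction (auto simp: hom_add)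
  then show ?thesis
    using assms by (simp add: scalar_prod_def hom_mult)
qed

lemma (in semiring_hom) hom_vec_add:
  "dim_vec v = dim_vec w \<Longrightarrow> map_vec hom (v + w) = map_vec hom v + map_vec hom w"
  by (intro eq_vecI) (auto simp: hom_add)

lemma mult_mat_vec_smult:
  fixes A :: "'a :: comm_semiring_0 mat"
  shows "dim_vec v = dim_col A \<Longrightarrow> A *\<^sub>v (k \<cdot>\<^sub>v v) = k \<cdot>\<^sub>v (A *\<^sub>v v)"
  by (intro eq_vecI) auto

lemma uminus_mult_mat:
  fixes A B :: "'a :: ring mat"
  assumes "A \<in> carrier_mat nr n" "B \<in> carrier_mat n nc"
  shows "- A * B = - (A * B)" and "A * - B = - (A * B)"
  using assms by simp_all

section \<open>The modules \<open>M(E, F)\<close>\<close>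

lemma mod_EF_simps [simp]:
  "carrier (mod_EF n E F) = carrier_vec n"
  "zero (mod_EF n E F) = 0\<^sub>v n"
  "add (mod_EF n E F) = (+)"
  "smult (mod_EF n E F) = (\<lambda>c g. [:c:] \<cdot>\<^sub>v g)"
  by (simp_all add: mod_EF_def sl2_extend_def)

lemma sl2_act_mod_EF:
  "sl2_act (mod_EF n E F) x v =
     [:coef_e x:] \<cdot>\<^sub>v (E *\<^sub>v map_vec sigma v) + [:coef_f x:] \<cdot>\<^sub>v (F *\<^sub>v map_vec sigma_inv v)
       + [:coef_h x:] \<cdot>\<^sub>v (hvar \<cdot>\<^sub>v v)"
  by (simp add: mod_EF_def sl2_extend_def)

lemma sl2_act_mod_EF_basis:
  assumes "E \<in> carrier_mat n n" "F \<in> carrier_mat n n" "v \<in> carrier_vec n"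
  shows "sl2_act (mod_EF n E F) sl2_e v = E *\<^sub>v map_vec sigma v"
    and "sl2_act (mod_EF n E F) sl2_f v = F *\<^sub>v map_vec sigma_inv v"
    and "sl2_act (mod_EF n E F) sl2_h v = hvar \<cdot>\<^sub>v v"
  using assms by (auto simp: sl2_act_mod_EF sl2_e_def sl2_f_def sl2_h_def intro!: eq_vecI)

lemma vectorspace_mod_EF: "vectorspace (class_ring :: complex ring) (mod_EF n E F)"
proof -
  have "abelian_group (mod_EF n E F)"
  proof (rule abelian_groupI)
    fix x assume "x \<in> carrier (mod_EF n E F)"
    then show "\<exists>y\<in>carrier (mod_EF n E F). y \<oplus>\<^bsub>mod_EF n E F\<^esub> x = \<zero>\<^bsub>mod_EF n E F\<^esub>"
      by (intro bexI[of _ "- x"]) auto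
  qed (auto simp: ac_simps)
  moreover have "[:a + b:] \<cdot>\<^sub>v x = [:a:] \<cdot>\<^sub>v x + [:b:] \<cdot>\<^sub>v x"
    "[:a * b:] \<cdot>\<^sub>v x = [:a:] \<cdot>\<^sub>v ([:b:] \<cdot>\<^sub>v x)"
    "[:1:] \<cdot>\<^sub>v x = x" for a b :: complex and x
    by (auto simp: smult_add_left smult_smult_assoc mult.commute)
  ultimately have "module (class_ring :: complex ring) (mod_EF n E F)"
    using class_field[where 'a = complex]
    by (intro moduleI) (auto simp: field_def domain_def smult_add_distrib_vec)
  then show ?thesis
    using class_field by (simp add: vectorspace_def)
qed

text \<open>Bracket relations are proved in additive form and converted by this rule, so the
  additive inverse of the structure need not be computed.\<close>

lemma (in abelian_group) eq_minusI:
  assumes "a \<in> carrier G" "b \<in> carrier G" "c \<in> carrier G" "a \<oplus> c = b"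
  shows "a = b \<ominus> c"
  using assms by (auto simp: a_minus_def a_assoc r_neg)

lemma sl2_act_mod_EF_closed:
  assumes "E \<in> carrier_mat n n" "F \<in> carrier_mat n n" "v \<in> carrier_vec n"
  shows "sl2_act (mod_EF n E F) x v \<in> carrier_vec n"
  using assms by (auto simp: sl2_act_mod_EF)

text \<open>The relations \<open>[h,e] = e\<close> and \<open>[h,f] = -f\<close> hold for all
  \<open>E\<close> and \<open>F\<close>, because the shifts turn the factor \<open>hvar\<close> into
  \<open>hvar - 1\<close> and \<open>hvar + 1\<close>. Only \<open>[e,f] = 2h\<close> constrains the
  matrices: \<open>EF\<close> is this relation with the subtracted term moved to the right. General
  brackets follow by bilinearity.\<close>

lemma sl2_module_mod_EF:
  assumes E: "E \<in> carrier_mat n n" and F: "F \<in> carrier_mat n n"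
    and EF: "E * map_mat sigma F = F * map_mat sigma_inv E + [:0, 2:] \<cdot>\<^sub>m 1\<^sub>m n"
  shows "sl2_module (mod_EF n E F)"
proof -
  interpret vectorspace "class_ring :: complex ring" "mod_EF n E F"
    by (rule vectorspace_mod_EF)
  define e where "e v = E *\<^sub>v map_vec sigma v" for v
  define f where "f v = F *\<^sub>v map_vec sigma_inv v" for v
  define h where "h v = hvar \<cdot>\<^sub>v v" for v :: "complex poly vec"
  let ?act = "sl2_act (mod_EF n E F)"
  have closed [simp]: "e v \<in> carrier_vec n" "f v \<in> carrier_vec n" "h v \<in> carrier_vec n"
    if "v \<in> carrier_vec n" for v
    using that E F by (auto simp: e_def f_def h_def)
  note [simp] = closed[THEN carrier_vecD]
  have add: "e (v + w) = e v + e w" "f (v + w) = f v + f w" "h (v + w) = h v + h w"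
    if "v \<in> carrier_vec n" "w \<in> carrier_vec n" for v w
    using that E F
    by (auto simp: e_def f_def h_def sigma.hom_vec_add sigma_inv.hom_vec_add smult_add_distrib_vec
        mult_add_distrib_mat_vec[of _ n n])
  have smult: "e ([:c:] \<cdot>\<^sub>v v) = [:c:] \<cdot>\<^sub>v e v" "f ([:c:] \<cdot>\<^sub>v v) = [:c:] \<cdot>\<^sub>v f v"
    "h ([:c:] \<cdot>\<^sub>v v) = [:c:] \<cdot>\<^sub>v h v" if "v \<in> carrier_vec n" for c v
    using that E F
    by (auto simp: e_def f_def h_def sigma.vec_hom_smult sigma_inv.vec_hom_smult mult_mat_vec_smult
        smult_smult_assoc mult.commute simp del: mult_pCons_left mult_pCons_right)
  have act: "?act x v = [:coef_e x:] \<cdot>\<^sub>v e v + [:coef_f x:] \<cdot>\<^sub>v f v + [:coef_h x:] \<cdot>\<^sub>v h v" for x v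
    by (simp add: sl2_act_mod_EF e_def f_def h_def)
  have he: "h (e v) = e (h v) + e v" if "v \<in> carrier_vec n" for v
    using that E mult_mat_vec_smult[of "map_vec sigma v" E "hvar - 1"]
    unfolding e_def h_def sigma.vec_hom_smult sigma_hvar
    by (auto simp: algebra_simps intro!: eq_vecI)
  have hf: "h (f v) + f v = f (h v)" if "v \<in> carrier_vec n" for v
    using that F mult_mat_vec_smult[of "map_vec sigma_inv v" F "hvar + 1"]
    unfolding f_def h_def sigma_inv.vec_hom_smult sigma_inv_hvar
    by (auto simp: algebra_simps intro!: eq_vecI)
  \<comment> \<open>The two shifts cancel on \<open>v\<close>, so both composites act as plain
    matrix products and \<open>EF\<close> applies.\<close>
  have ef: "e (f v) = f (e v) + [:2:] \<cdot>\<^sub>v h v" if v: "v \<in> carrier_vec n" for v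
  proof -
    have "e (f v) = (E * map_mat sigma F) *\<^sub>v v"
      using v E F unfolding e_def f_def
      by (subst sigma.mult_mat_vec_hom[of _ n n]) (auto simp: assoc_mult_mat_vec[of _ n n _ n])
    moreover have "f (e v) = (F * map_mat sigma_inv E) *\<^sub>v v"
      using v E F unfolding e_def f_def
      by (subst sigma_inv.mult_mat_vec_hom[of _ n n]) (auto simp: assoc_mult_mat_vec[of _ n n _ n])
    moreover have "([:0, 2:] \<cdot>\<^sub>m 1\<^sub>m n) *\<^sub>v v = [:2:] \<cdot>\<^sub>v h v"
      using v by (auto simp: h_def intro!: eq_vecI)
    ultimately show ?thesis
      using v E F unfolding EF by (simp add: add_mult_distrib_mat_vec[of _ n n])
  qed
  show ?thesis
  proof unfold_locales
    show "?act x \<in> module_hom class_ring (mod_EF n E F) (mod_EF n E F)" for x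
      by (auto simp: LinearCombinations.module_hom_def act add smult algebra_simps intro!: eq_vecI)
  next
    fix v x y assume "v \<in> carrier (mod_EF n E F)"
    then have v: "v \<in> carrier_vec n" by simp
    then show "?act (sl2_add x y) v = ?act x v \<oplus>\<^bsub>mod_EF n E F\<^esub> ?act y v"
      by (auto simp: act sl2_add_def algebra_simps smult_add_left intro!: eq_vecI)
    show "?act (sl2_bracket x y) v = ?act x (?act y v) \<ominus>\<^bsub>mod_EF n E F\<^esub> ?act y (?act x v)"
    proof (rule eq_minusI)
      \<comment> \<open>The words \<open>h e\<close>, \<open>f h\<close> and \<open>e f\<close> are
        reordered to \<open>e h\<close>, \<open>h f\<close> and \<open>f e\<close>; each correction
        term enters with a plus sign, so no reordering introduces a subtraction.\<close>
      show "?act (sl2_bracket x y) v \<oplus>\<^bsub>mod_EF n E F\<^esub> ?act y (?act x v) = ?act x (?act y v)"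
        using v
        by (intro eq_vecI)
          (auto simp: act add smult ef he hf[symmetric] sl2_bracket_def algebra_simps smult_add_left
            smult_add_right smult_diff_left)
    qed (use v E F in \<open>auto simp: sl2_act_mod_EF_closed\<close>)
  next
    fix v x c assume "v \<in> carrier (mod_EF n E F)"
    then show "?act (sl2_scale c x) v = c \<odot>\<^bsub>mod_EF n E F\<^esub> ?act x v"
      by (auto simp: act sl2_scale_def algebra_simps smult_add_right intro!: eq_vecI)
  qed
qed

text \<open>Since \<open>h\<close> acts as multiplication by the variable, its \<open>i\<close>-th
  power multiplies by \<open>monom 1 i\<close>, and the sum in \<open>Uh_module\<close> reassembles
  \<open>p\<close>. The underlying module is thus the usual free one.\<close>

lemma smult_Uh_module_mod_EF:
  assumes E: "E \<in> carrier_mat n n" and F: "F \<in> carrier_mat n n" and v: "v \<in> carrier_vec n"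
  shows "p \<odot>\<^bsub>Uh_module (mod_EF n E F)\<^esub> v = p \<cdot>\<^sub>v v"
proof -
  let ?V = "mod_EF n E F"
  interpret vectorspace "class_ring :: complex ring" ?V
    by (rule vectorspace_mod_EF)
  have pow: "(sl2_act ?V sl2_h ^^ i) v = monom 1 i \<cdot>\<^sub>v v" for i
    using v by (induction i) (auto simp: sl2_act_mod_EF_basis(3)[OF E F] smult_smult_assoc monom_Suc)
  \<comment> \<open>The upper bound is detached from \<open>degree p\<close> to allow induction on
    it.\<close>
  have "(\<Oplus>\<^bsub>?V\<^esub>i\<in>{..d}. coeff p i \<odot>\<^bsub>?V\<^esub> (sl2_act ?V sl2_h ^^ i) v)
      = (\<Sum>i\<le>d. monom (coeff p i) i) \<cdot>\<^sub>v v" for d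
  proof (induction d)
    case 0
    show ?case
      using v by (simp add: pow smult_smult_assoc smult_monom)
  next
    case (Suc d)
    then show ?case
      using v by (subst finsum_Suc)
        (auto simp: pow smult_smult_assoc smult_monom add_smult_distrib_vec comm_add_vec[of _ n]
          simp del: funpow.simps)
  qed
  then show ?thesis
    by (simp add: Uh_module_def poly_as_sum_of_monoms)
qed

section \<open>Duality\<close>

text \<open>The structure on \<open>V\<close> is not assumed to satisfy any axioms: they are transported from \<open>W\<close>.\<close>

lemma sl2_isoI_transport:
  assumes W: "sl2_module W" and bij: "bij_betw \<phi> (carrier W) (carrier V)"
    and zero: "\<phi> \<zero>\<^bsub>W\<^esub> = \<zero>\<^bsub>V\<^esub>"
    and add: "\<And>v w. v \<in> carrier W \<Longrightarrow> w \<in> carrier W \<Longrightarrow> \<phi> (v \<oplus>\<^bsub>W\<^esub> w) = \<phi> v \<oplus>\<^bsub>V\<^esub> \<phi> w"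
    and smult: "\<And>c v. v \<in> carrier W \<Longrightarrow> \<phi> (c \<odot>\<^bsub>W\<^esub> v) = c \<odot>\<^bsub>V\<^esub> \<phi> v"
    and act: "\<And>x v. v \<in> carrier W \<Longrightarrow> \<phi> (sl2_act W x v) = sl2_act V x (\<phi> v)"
  shows "V \<simeq> W"
proof -
  interpret W: sl2_module W by (rule W)
  have carrier_V: "carrier V = \<phi> ` carrier W"
    using bij by (simp add: bij_betw_def)
  have act_W [simp]: "sl2_act W x v \<in> carrier W" if "v \<in> carrier W" for x v
    using that W.act_hom[of x] by (auto simp: LinearCombinations.module_hom_def)
  have smult_W [simp]: "c \<odot>\<^bsub>W\<^esub> v \<in> carrier W" if "v \<in> carrier W" for c v
    using that by (intro W.smult_closed) auto
  \<comment> \<open>Read backwards, the hypotheses gather an expression in \<open>V\<close> into the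
    image of one in \<open>W\<close>, so each axiom for \<open>V\<close> is the image of the same
    axiom for \<open>W\<close>.\<close>
  note transport = add[symmetric] smult[symmetric] act[symmetric] zero[symmetric]
  have "abelian_group V"
  proof (rule abelian_groupI)
    fix x assume "x \<in> carrier V"
    then obtain v where v: "v \<in> carrier W" "x = \<phi> v" by (auto simp: carrier_V)
    then show "\<exists>y\<in>carrier V. y \<oplus>\<^bsub>V\<^esub> x = \<zero>\<^bsub>V\<^esub>"
      by (intro bexI[of _ "\<phi> (\<ominus>\<^bsub>W\<^esub> v)"]) (auto simp: carrier_V transport W.l_neg)
  qed (auto simp: carrier_V transport W.a_ac)
  moreover have "module (class_ring :: complex ring) V"
    using calculation class_field[where 'a = complex] W.smult_l_distr W.smult_r_distr W.smult_assoc1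
      W.smult_one
    by (intro moduleI) (auto simp: field_def domain_def carrier_V transport)
  then interpret V: vectorspace "class_ring :: complex ring" V
    using class_field by (simp add: vectorspace_def)
  have "sl2_module V"
  proof unfold_locales
    fix x
    show "sl2_act V x \<in> module_hom class_ring V V"
      using W.act_hom[of x] by (auto simp: LinearCombinations.module_hom_def carrier_V transport)
  next
    fix v x y assume "v \<in> carrier V"
    then obtain w where w: "w \<in> carrier W" "v = \<phi> w" by (auto simp: carrier_V)
    then show "sl2_act V (sl2_add x y) v = sl2_act V x v \<oplus>\<^bsub>V\<^esub> sl2_act V y v"
      by (simp add: transport W.act_add)
    \<comment> \<open>The bracket law passes through \<open>\<phi>\<close> as a sum, since
      compatibility with subtraction is not among the hypotheses.\<close>
    have "sl2_act W (sl2_bracket x y) w \<oplus>\<^bsub>W\<^esub> sl2_act W y (sl2_act W x w)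
        = sl2_act W x (sl2_act W y w)"
      using w by (simp add: W.act_bracket a_minus_def W.a_assoc W.l_neg)
    then have "sl2_act V (sl2_bracket x y) v \<oplus>\<^bsub>V\<^esub> sl2_act V y (sl2_act V x v)
        = sl2_act V x (sl2_act V y v)"
      using w by (simp add: transport)
    then show "sl2_act V (sl2_bracket x y) v
        = sl2_act V x (sl2_act V y v) \<ominus>\<^bsub>V\<^esub> sl2_act V y (sl2_act V x v)"
      using w by (intro V.eq_minusI) (auto simp: transport carrier_V)
  next
    fix v x c assume "v \<in> carrier V"
    then show "sl2_act V (sl2_scale c x) v = c \<odot>\<^bsub>V\<^esub> sl2_act V x v"
      by (auto simp: carrier_V transport W.act_scale)
  qed
  moreover have inv: "inv_into (carrier W) \<phi> (\<phi> v) = v" if "v \<in> carrier W" for v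
    using bij that by (simp add: bij_betw_def)
  \<comment> \<open>The map demanded by \<open>V \<simeq> W\<close> starts at \<open>V\<close>, so
    it is the inverse of \<open>\<phi>\<close>.\<close>
  have "inv_into (carrier W) \<phi> \<in> module_hom (class_ring :: complex ring) V W"
    by (auto simp: LinearCombinations.module_hom_def carrier_V transport inv)
  moreover have "\<forall>x. \<forall>v\<in>carrier V.
      inv_into (carrier W) \<phi> (sl2_act V x v) = sl2_act W x (inv_into (carrier W) \<phi> v)"
    by (auto simp: carrier_V transport inv)
  ultimately show ?thesis
    using W bij_betw_inv_into[OF bij] unfolding sl2_iso_def by blast
qed

text \<open>The vector \<open>m\<close> is built up through its truncations, each obtained from the
  previous one by adding a multiple of a unit vector, and linearity is applied at every
  stage.\<close>

lemma linear_functional_eq_scalar_prod: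
  fixes g :: "'a :: comm_ring_1 vec \<Rightarrow> 'a"
  assumes add: "\<And>v w. v \<in> carrier_vec n \<Longrightarrow> w \<in> carrier_vec n \<Longrightarrow> g (v + w) = g v + g w"
    and smult: "\<And>c v. v \<in> carrier_vec n \<Longrightarrow> g (c \<cdot>\<^sub>v v) = c * g v"
    and m: "m \<in> carrier_vec n"
  shows "g m = vec n (\<lambda>i. g (unit_vec n i)) \<bullet> m"
proof -
  let ?trunc = "\<lambda>k. vec n (\<lambda>i. if i < k then m $ i else 0)"
  have trunc: "g (?trunc k) = (\<Sum>i<k. g (unit_vec n i) * m $ i)" if "k \<le> n" for k
    using that
  proof (induction k)
    case 0
    \<comment> \<open>Homogeneity with factor 0 then gives the value 0 at the zero vector.\<close>
    have "?trunc 0 = 0 \<cdot>\<^sub>v 0\<^sub>v n" by auto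
    then show ?case using smult[of "0\<^sub>v n" 0] by simp
  next
    case (Suc k)
    have "?trunc (Suc k) = ?trunc k + m $ k \<cdot>\<^sub>v unit_vec n k"
      using Suc.prems by (intro eq_vecI) (auto simp: unit_vec_def less_Suc_eq)
    then have "g (?trunc (Suc k)) = g (?trunc k) + m $ k * g (unit_vec n k)"
      by (simp add: add smult)
    with Suc show ?case by (simp add: mult.commute)
  qed
  have "?trunc n = m" using m by auto
  then show ?thesis
    using m trunc[of n] by (simp add: scalar_prod_def atLeast0LessThan)
qed

lemma Uh_dual_simps:
  "zero (Uh_dual V) = (\<lambda>m \<in> carrier V. 0)"
  "add (Uh_dual V) = (\<lambda>g g'. \<lambda>m \<in> carrier V. g m + g' m)"
  "smult (Uh_dual V) = (\<lambda>c g. \<lambda>m \<in> carrier V. [:c:] * g m)"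
  by (simp_all add: Uh_dual_def sl2_extend_def)

text \<open>By \<open>smult_Uh_module_mod_EF\<close> the scalars of \<open>Uh_module\<close> act by
  ordinary multiplication, so the homomorphism condition becomes linearity over polynomials in the
  usual sense.\<close>

lemma carrier_Uh_dual_mod_EF:
  assumes "E \<in> carrier_mat n n" and "F \<in> carrier_mat n n"
  shows "carrier (Uh_dual (mod_EF n E F)) = {g \<in> extensional (carrier_vec n).
    (\<forall>v\<in>carrier_vec n. \<forall>w\<in>carrier_vec n. g (v + w) = g v + g w) \<and>
    (\<forall>c. \<forall>v\<in>carrier_vec n. g (c \<cdot>\<^sub>v v) = c * g v)}"
proof -
  have "carrier (Uh_module (mod_EF n E F)) = carrier_vec n" "add (Uh_module (mod_EF n E F)) = (+)"
    by (simp_all add: Uh_module_def)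
  then show ?thesis
    by (auto simp: Uh_dual_def sl2_extend_def LinearCombinations.module_hom_def poly_module_def
        smult_Uh_module_mod_EF[OF assms])
qed

text \<open>The vector \<open>w\<close> of \<open>M(E', F')\<close> corresponds to the functional \<open>m \<mapsto> (S w)\<^sup>T m\<close>.\<close>

lemma Uh_dual_mod_EF_iso:
  assumes E: "E \<in> carrier_mat n n" and F: "F \<in> carrier_mat n n"
    and E': "E' \<in> carrier_mat n n" and F': "F' \<in> carrier_mat n n"
    and EF': "E' * map_mat sigma F' = F' * map_mat sigma_inv E' + [:0, 2:] \<cdot>\<^sub>m 1\<^sub>m n"
    and S: "S \<in> carrier_mat n n" "S' \<in> carrier_mat n n" "S * S' = 1\<^sub>m n" "S' * S = 1\<^sub>m n"
    and sigma_S: "map_mat sigma S = S"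
    and SE': "S * E' = transpose_mat (map_mat sigma F) * S"
    and SF': "S * F' = transpose_mat (map_mat sigma_inv E) * S"
  shows "Uh_dual (mod_EF n E F) \<simeq> mod_EF n E' F'"
proof (rule sl2_isoI_transport)
  let ?V = "Uh_dual (mod_EF n E F)" and ?W = "mod_EF n E' F'"
  let ?\<phi> = "\<lambda>w. \<lambda>m\<in>carrier_vec n. (S *\<^sub>v w) \<bullet> m"
  note carrier_V = carrier_Uh_dual_mod_EF[OF E F]
  have Sw: "S *\<^sub>v w \<in> carrier_vec n" for w
    using S by (auto intro!: carrier_vecI)
  have [simp]: "dim_row S = n"
    using S by auto
  have sigma_inv_S: "map_mat sigma_inv S = S"
    using sigma_S by (metis map_mat_sigma_inv_sigma)
  show "sl2_module ?W"
    by (rule sl2_module_mod_EF[OF E' F' EF'])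
  show "bij_betw ?\<phi> (carrier ?W) (carrier ?V)"
  proof (rule bij_betw_imageI)
    show "inj_on ?\<phi> (carrier ?W)"
    proof (rule inj_onI)
      fix v w assume "v \<in> carrier ?W" "w \<in> carrier ?W" and eq: "?\<phi> v = ?\<phi> w"
      then have vw: "v \<in> carrier_vec n" "w \<in> carrier_vec n" by auto
      \<comment> \<open>Pairing with unit vectors reads off the entries of
        \<open>S *\<^sub>v v\<close>; multiplying by \<open>S'\<close> then recovers
        \<open>v\<close>.\<close>
      have "(S *\<^sub>v v) $ i = (S *\<^sub>v w) $ i" if "i < n" for i
        using fun_cong[OF eq, of "unit_vec n i"] that by simp
      then have "S *\<^sub>v v = S *\<^sub>v w"
        using S by (intro eq_vecI) auto
      then have "S' *\<^sub>v (S *\<^sub>v v) = S' *\<^sub>v (S *\<^sub>v w)"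
        by simp
      then show "v = w"
        using S vw assoc_mult_mat_vec[of S' n n S n, symmetric] by (simp del: assoc_mult_mat_vec)
    qed
    show "?\<phi> ` carrier ?W = carrier ?V"
    proof (intro equalityI subsetI)
      fix g assume "g \<in> ?\<phi> ` carrier ?W"
      then show "g \<in> carrier ?V"
        by (auto simp: carrier_V scalar_prod_add_distrib[OF Sw])
    next
      fix g assume "g \<in> carrier ?V"
      then have g: "g \<in> extensional (carrier_vec n)"
        and g_add: "\<And>v w. v \<in> carrier_vec n \<Longrightarrow> w \<in> carrier_vec n \<Longrightarrow> g (v + w) = g v + g w"
        and g_smult: "\<And>c v. v \<in> carrier_vec n \<Longrightarrow> g (c \<cdot>\<^sub>v v) = c * g v"
        unfolding carrier_V by blast+
      \<comment> \<open>This is the coordinate vector of \<open>g\<close>; the preimage of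
        \<open>g\<close> is \<open>S' *\<^sub>v ?w\<close>, because the parametrisation multiplies
        by \<open>S\<close>.\<close>
      let ?w = "vec n (\<lambda>i. g (unit_vec n i))"
      have "S *\<^sub>v (S' *\<^sub>v ?w) = ?w"
        using S assoc_mult_mat_vec[of S n n S' n ?w, symmetric] by (simp del: assoc_mult_mat_vec)
      then have "?\<phi> (S' *\<^sub>v ?w) m = g m" if "m \<in> carrier_vec n" for m
        using linear_functional_eq_scalar_prod[of n g, OF g_add g_smult that] that by simp
      then have "g = ?\<phi> (S' *\<^sub>v ?w)"
        by (intro extensionalityI[OF g restrict_extensional]) simp
      then show "g \<in> ?\<phi> ` carrier ?W"
        using S by auto
    qed
  qed
  show "?\<phi> \<zero>\<^bsub>?W\<^esub> = \<zero>\<^bsub>?V\<^esub>"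
    unfolding Uh_dual_simps mod_EF_simps using S(1)
    by (intro restrict_ext) (simp add: scalar_prod_def)
  show "?\<phi> (v \<oplus>\<^bsub>?W\<^esub> w) = ?\<phi> v \<oplus>\<^bsub>?V\<^esub> ?\<phi> w" if "v \<in> carrier ?W" "w \<in> carrier ?W" for v w
    unfolding Uh_dual_simps mod_EF_simps using S that
    by (intro restrict_ext)
      (simp add: mult_add_distrib_mat_vec[of _ n n] add_scalar_prod_distrib[of _ n])
  show "?\<phi> (c \<odot>\<^bsub>?W\<^esub> v) = c \<odot>\<^bsub>?V\<^esub> ?\<phi> v" if "v \<in> carrier ?W" for c v
    unfolding Uh_dual_simps mod_EF_simps using S that
    by (intro restrict_ext) (simp add: mult_mat_vec_smult)
  show "?\<phi> (sl2_act ?W x v) = sl2_act ?V x (?\<phi> v)" if "v \<in> carrier ?W" for x v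
  proof -
    have v: "v \<in> carrier_vec n" using that by simp
    \<comment> \<open>On the dual, \<open>e\<close> precomposes with \<open>f\<close> and then
      applies \<open>sigma\<close>. The shifts cancel on \<open>m\<close>, \<open>sigma\<close>
      fixes \<open>S\<close>, and transposing the shifted \<open>F\<close> to the other factor
      brings in \<open>SE'\<close>.\<close>
    have e: "sigma ((S *\<^sub>v v) \<bullet> (F *\<^sub>v map_vec sigma_inv m)) = (S *\<^sub>v (E' *\<^sub>v map_vec sigma v)) \<bullet> m"
      if m: "m \<in> carrier_vec n" for m
    proof -
      have "sigma ((S *\<^sub>v v) \<bullet> (F *\<^sub>v map_vec sigma_inv m))
          = (S *\<^sub>v map_vec sigma v) \<bullet> (map_mat sigma F *\<^sub>v m)"
        using F sigma.mult_mat_vec_hom[OF S(1) v] m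
          sigma.mult_mat_vec_hom[OF F, of "map_vec sigma_inv m"]
        by (subst sigma.hom_scalar_prod) (simp_all add: sigma_S)
      also have "\<dots> = (transpose_mat (map_mat sigma F) *\<^sub>v (S *\<^sub>v map_vec sigma v)) \<bullet> m"
        using F v m by (intro transpose_vec_mult_scalar[symmetric, of _ n n] Sw) simp_all
      also have "transpose_mat (map_mat sigma F) *\<^sub>v (S *\<^sub>v map_vec sigma v)
          = S *\<^sub>v (E' *\<^sub>v map_vec sigma v)"
        using S F E' v assoc_mult_mat_vec[of S n n E' n "map_vec sigma v"]
          assoc_mult_mat_vec[of "transpose_mat (map_mat sigma F)" n n S n "map_vec sigma v"]
        by (simp only: SE' transpose_carrier_mat map_carrier_mat map_carrier_vec)
      finally show ?thesis .
    qed
    \<comment> \<open>The mirror computation for \<open>f\<close>, with \<open>sigma_inv_S\<close>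
      and \<open>SF'\<close>.\<close>
    have f: "sigma_inv ((S *\<^sub>v v) \<bullet> (E *\<^sub>v map_vec sigma m))
        = (S *\<^sub>v (F' *\<^sub>v map_vec sigma_inv v)) \<bullet> m" if m: "m \<in> carrier_vec n" for m
    proof -
      have "sigma_inv ((S *\<^sub>v v) \<bullet> (E *\<^sub>v map_vec sigma m))
          = (S *\<^sub>v map_vec sigma_inv v) \<bullet> (map_mat sigma_inv E *\<^sub>v m)"
        using E sigma_inv.mult_mat_vec_hom[OF S(1) v] m
          sigma_inv.mult_mat_vec_hom[OF E, of "map_vec sigma m"]
        by (subst sigma_inv.hom_scalar_prod) (simp_all add: sigma_inv_S)
      also have "\<dots> = (transpose_mat (map_mat sigma_inv E) *\<^sub>v (S *\<^sub>v map_vec sigma_inv v)) \<bullet> m"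
        using E v m by (intro transpose_vec_mult_scalar[symmetric, of _ n n] Sw) simp_all
      also have "transpose_mat (map_mat sigma_inv E) *\<^sub>v (S *\<^sub>v map_vec sigma_inv v)
          = S *\<^sub>v (F' *\<^sub>v map_vec sigma_inv v)"
        using S E F' v assoc_mult_mat_vec[of S n n F' n "map_vec sigma_inv v"]
          assoc_mult_mat_vec[of "transpose_mat (map_mat sigma_inv E)" n n S n "map_vec sigma_inv v"]
        by (simp only: SF' transpose_carrier_mat map_carrier_mat map_carrier_vec)
      finally show ?thesis .
    qed
    show ?thesis
    proof (rule extensionalityI[of _ "carrier_vec n"])
      fix m :: "complex poly vec" assume m: "m \<in> carrier_vec n"
      have "E *\<^sub>v map_vec sigma m \<in> carrier_vec n" "F *\<^sub>v map_vec sigma_inv m \<in> carrier_vec n"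
        using E F m by (simp_all add: mult_mat_vec_carrier[of _ n n])
      with m have "sl2_act ?V x (?\<phi> v) m
          = [:coef_e x:] * ((S *\<^sub>v (E' *\<^sub>v map_vec sigma v)) \<bullet> m)
            + [:coef_f x:] * ((S *\<^sub>v (F' *\<^sub>v map_vec sigma_inv v)) \<bullet> m)
            + [:coef_h x:] * (hvar * ((S *\<^sub>v v) \<bullet> m))"
        by (simp add: Uh_dual_def sl2_extend_def sl2_act_mod_EF_basis[OF E F] e f
            del: mult_pCons_left mult_pCons_right)
      also have "\<dots> = (S *\<^sub>v sl2_act ?W x v) \<bullet> m"
        using S E' F' v m
        by (simp add: sl2_act_mod_EF mult_add_distrib_mat_vec[of _ n n] mult_mat_vec_smult
            add_scalar_prod_distrib[of _ n] del: mult_pCons_left mult_pCons_right)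
      finally show "?\<phi> (sl2_act ?W x v) m = sl2_act ?V x (?\<phi> v) m"
        using m by simp
    qed (auto simp: Uh_dual_def sl2_extend_def)
  qed
qed

section \<open>The family \<open>M(\<alpha>, a, K)\<close>\<close>

text \<open>As a polynomial, \<open>lam \<alpha>\<close> is \<open>- hvar^2 - hvar\<close> plus a
  constant depending on \<alpha>, so the shift adds \<open>2h\<close> for every \<alpha>. This is
  the source of \<open>[e,f] = 2h\<close> in the family.\<close>

lemma sigma_lam: "sigma (lam \<alpha>) = lam \<alpha> + [:0, 2:]"
  by (simp add: lam_def sigma_def pcompose_pCons one_pCons algebra_simps)

lemma P_mat_carrier [simp]: "P_mat a \<alpha> \<in> carrier_mat (asize a) (asize a)"
  by (simp add: P_mat_def)

text \<open>Uniqueness in \<open>P_bar_ex1\<close> makes the definite description computable: it is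
  evaluated below both by quotients of \<open>lam \<alpha>\<close> and by negated reversed
  entries.\<close>

lemma P_bar_eqI:
  assumes "\<And>i. i < asize a \<Longrightarrow> q i * P_entries a \<alpha> ! i = lam \<alpha>"
  shows "P_bar a \<alpha> = mat_diag (asize a) q"
  unfolding P_bar_def
proof (rule the1_equality[OF P_bar_ex1], intro conjI)
  show "mat_diag (asize a) q * P_mat a \<alpha> = lam \<alpha> \<cdot>\<^sub>m 1\<^sub>m (asize a)"
    using assms by (auto simp: P_mat_def intro!: eq_matI) (auto simp: mat_diag_def)
qed (auto simp: mat_diag_def diagonal_mat_def)

lemma P_bar_props:
  shows P_bar_carrier [simp]: "P_bar a \<alpha> \<in> carrier_mat (asize a) (asize a)"
    and P_bar_mult_P_mat: "P_bar a \<alpha> * P_mat a \<alpha> = lam \<alpha> \<cdot>\<^sub>m 1\<^sub>m (asize a)"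
    and P_mat_mult_P_bar: "P_mat a \<alpha> * P_bar a \<alpha> = lam \<alpha> \<cdot>\<^sub>m 1\<^sub>m (asize a)"
proof -
  have *: "lam \<alpha> div P_entries a \<alpha> ! i * P_entries a \<alpha> ! i = lam \<alpha>" if "i < asize a" for i
    using P_entries_dvd_lam[OF that] by simp
  have eq: "P_bar a \<alpha> = mat_diag (asize a) (\<lambda>i. lam \<alpha> div P_entries a \<alpha> ! i)"
    by (rule P_bar_eqI) (rule *)
  show "P_bar a \<alpha> \<in> carrier_mat (asize a) (asize a)"
    by (simp add: eq)
  show "P_bar a \<alpha> * P_mat a \<alpha> = lam \<alpha> \<cdot>\<^sub>m 1\<^sub>m (asize a)"
    "P_mat a \<alpha> * P_bar a \<alpha> = lam \<alpha> \<cdot>\<^sub>m 1\<^sub>m (asize a)"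
    using * by (auto simp: P_mat_def eq mult.commute intro!: eq_matI)
      (auto simp: mat_diag_def mult.commute)
qed

section \<open>Invertible matrices and the defining relation of the family\<close>

lemma GL_D:
  assumes "K \<in> GL n"
  shows "K \<in> carrier_mat n n" "GL_inv n K \<in> carrier_mat n n"
    "GL_inv n K * K = 1\<^sub>m n" "K * GL_inv n K = 1\<^sub>m n"
proof -
  interpret ring "ring_mat TYPE(complex poly) n ()" by (rule ring_mat)
  show "K \<in> carrier_mat n n" "GL_inv n K \<in> carrier_mat n n"
    "GL_inv n K * K = 1\<^sub>m n" "K * GL_inv n K = 1\<^sub>m n"
    using assms Units_closed Units_inv_closed Units_l_inv Units_r_inv by (simp_all add: ring_mat_simps)
qed

lemma GL_I:
  assumes "K \<in> carrier_mat n n" "L \<in> carrier_mat n n" "L * K = 1\<^sub>m n" "K * L = 1\<^sub>m n"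
  shows "K \<in> GL n" "GL_inv n K = L"
proof -
  interpret ring "ring_mat TYPE(complex poly) n ()" by (rule ring_mat)
  show "K \<in> GL n"
    using assms by (auto simp: Units_def ring_mat_simps)
  show "GL_inv n K = L"
    using inv_unique'[of K L] assms by (simp add: ring_mat_simps)
qed

text \<open>For \<open>A = GL_inv (asize a) K * P_bar a \<alpha>\<close>, both \<open>A * F\<close>
  and \<open>F * A\<close> are the scalar matrix of \<open>lam \<alpha>\<close>. As \<open>E\<close>
  is the shift of \<open>A\<close>, the two products in the relation are the scalar matrices of
  \<open>sigma (lam \<alpha>)\<close> and \<open>lam \<alpha>\<close>, which differ by
  \<open>2h\<close>.\<close>

lemma mod_alpha_relation:
  fixes a \<alpha> K
  defines "E \<equiv> map_mat sigma (GL_inv (asize a) K * P_bar a \<alpha>)" and "F \<equiv> P_mat a \<alpha> * K"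
  assumes K: "K \<in> GL (asize a)"
  shows "E * map_mat sigma F = F * map_mat sigma_inv E + [:0, 2:] \<cdot>\<^sub>m 1\<^sub>m (asize a)"
proof -
  let ?n = "asize a" and ?L = "GL_inv (asize a) K"
  let ?A = "?L * P_bar a \<alpha>" and ?lam = "lam \<alpha> \<cdot>\<^sub>m 1\<^sub>m (asize a)"
  note K = GL_D[OF K]
  note [simp] = mult_carrier_mat[of _ ?n ?n _ ?n]
  note assoc = assoc_mult_mat[of _ ?n ?n _ ?n _ ?n]
  have "?A * F = ?L * ((P_bar a \<alpha> * P_mat a \<alpha>) * K)"
    using K by (simp add: F_def assoc[of ?L "P_bar a \<alpha>"] assoc[of "P_bar a \<alpha>" "P_mat a \<alpha>"])
  also have "\<dots> = lam \<alpha> \<cdot>\<^sub>m (?L * K)"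
    using K by (simp add: P_bar_mult_P_mat mult_smult_assoc_mat[of _ ?n ?n _ ?n]
        mult_smult_distrib[of _ ?n ?n _ ?n])
  finally have AF: "?A * F = ?lam" using K by simp
  have "F * ?A = P_mat a \<alpha> * ((K * ?L) * P_bar a \<alpha>)"
    using K(1,2) by (simp add: F_def assoc[of "P_mat a \<alpha>" K] assoc[of K ?L])
  then have FA: "F * ?A = ?lam"
    using K by (simp add: P_mat_mult_P_bar left_mult_one_mat[of _ ?n ?n])
  have "E * map_mat sigma F = map_mat sigma (?A * F)"
    using K sigma.mat_hom_mult[of ?A ?n ?n F ?n] by (simp add: E_def F_def)
  also have "\<dots> = ?lam + [:0, 2:] \<cdot>\<^sub>m 1\<^sub>m ?n"
    unfolding AF by (intro eq_matI) (auto simp: sigma_lam)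
  also have "?lam = F * map_mat sigma_inv E"
    unfolding FA[symmetric] E_def by simp
  finally show ?thesis .
qed

text \<open>After reversal the block of ones faces the block of full products, and the middle block
  faces one of equal length in which the sign change of \<open>a0\<close> has swapped the two linear
  factors.\<close>

lemma P_entries_mult_reversed:
  assumes i: "i < asize (am, a0, ap)"
  shows "P_entries (am, a0, ap) \<alpha> ! i
      * P_entries (ap, - a0, am) \<alpha> ! (asize (am, a0, ap) - 1 - i) = - lam \<alpha>"
proof -
  define u v where "u = hvar - [:\<alpha>:] + 1" and "v = hvar + [:\<alpha>:]"
  let ?n = "asize (am, a0, ap)"
  have "asize (ap, - a0, am) = ?n"
    by (simp add: asize_def)
  then have "P_entries (ap, - a0, am) \<alpha> ! (?n - 1 - i) = rev (P_entries (ap, - a0, am) \<alpha>) ! i"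
    using i by (subst rev_nth) (simp_all add: P_entries_length)
  \<comment> \<open>The test \<open>a0 \<le> 0\<close> comes from \<open>- a0 \<ge> 0\<close>. It
    overlaps with \<open>a0 \<ge> 0\<close> only at 0, where the middle block is empty.\<close>
  also have "rev (P_entries (ap, - a0, am) \<alpha>) = replicate am (u * v)
      @ replicate (nat \<bar>a0\<bar>) (if a0 \<le> 0 then u else v) @ replicate ap 1"
    by (simp add: P_entries_def u_def v_def del: mult_pCons_left mult_pCons_right)
  moreover have "P_entries (am, a0, ap) \<alpha> = replicate am 1
      @ replicate (nat \<bar>a0\<bar>) (if a0 \<ge> 0 then u else v) @ replicate ap (u * v)"
    by (simp add: P_entries_def u_def v_def del: mult_pCons_left mult_pCons_right)
  moreover have "lam \<alpha> = - (u * v)"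
    by (simp add: lam_def u_def v_def)
  moreover have "i < am + (nat \<bar>a0\<bar> + ap)"
    using i by (simp add: asize_def)
  ultimately show ?thesis
    by (auto simp: nth_append mult.commute)
qed

section \<open>The antidiagonal permutation and reversal of diagonals\<close>

lemma antidiag_carrier [simp]: "antidiag n \<in> carrier_mat n n"
  by (simp add: antidiag_def)

lemma sigma_antidiag: "map_mat sigma (antidiag n) = antidiag n"
  by (auto simp: antidiag_def)

lemma antidiag_mult_index:
  assumes A: "A \<in> carrier_mat n n" and ij: "i < n" "j < n"
  shows "(antidiag n * A) $$ (i, j) = A $$ (n - 1 - i, j)"
proof -
  have "(antidiag n * A) $$ (i, j)
      = (\<Sum>k<n. (if i + k + 1 = n then 1 else 0) * A $$ (k, j))"
    using A ij by (simp add: antidiag_def scalar_prod_def atLeast0LessThan)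
  also have "\<dots> = (\<Sum>k<n. if k = n - 1 - i then A $$ (k, j) else 0)"
    using ij by (intro sum.cong) auto
  finally show ?thesis using ij by simp
qed

lemma antidiag_mult_antidiag: "antidiag n * antidiag n = 1\<^sub>m n"
  by (intro eq_matI) (auto simp: antidiag_mult_index simp del: index_mult_mat(1),
      auto simp: antidiag_def)

text \<open>The nonzero entries of \<open>antidiag n\<close> have column index
  \<open>n - 1 - i\<close> in row \<open>i\<close>, so scaling its columns is scaling its rows in
  reverse order.\<close>

lemma antidiag_mat_diag:
  "antidiag n * mat_diag n q = mat_diag n (\<lambda>i. q (n - 1 - i)) * antidiag n"
  by (simp add: mat_diag_mult_left[of _ n n] mat_diag_mult_right[of _ n n])
    (auto simp: antidiag_def intro!: eq_matI)

text \<open>Facing entries multiply to \<open>- lam \<alpha>\<close>, so each is minus the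
  complementary factor of the other. This sign is what the minus sign in front of the new matrix of
  the theorem compensates.\<close>

lemma P_bar_reversed:
  assumes "asize (am, a0, ap) = n"
  shows "antidiag n * P_bar (am, a0, ap) \<alpha> = - (P_mat (ap, - a0, am) \<alpha> * antidiag n)"
    and "antidiag n * P_mat (am, a0, ap) \<alpha> = - (P_bar (ap, - a0, am) \<alpha> * antidiag n)"
proof -
  let ?p = "\<lambda>i. P_entries (am, a0, ap) \<alpha> ! i" and ?p' = "\<lambda>i. P_entries (ap, - a0, am) \<alpha> ! i"
  have n: "asize (ap, - a0, am) = n"
    using assms by (simp add: asize_def)
  have mult: "?p i * ?p' (n - 1 - i) = - lam \<alpha>" if "i < n" for i
    using P_entries_mult_reversed[of i am a0 ap \<alpha>] that assms by simp
  have "P_bar (am, a0, ap) \<alpha> = mat_diag n (\<lambda>i. - ?p' (n - 1 - i))"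
    using P_bar_eqI[of "(am, a0, ap)" "\<lambda>i. - ?p' (n - 1 - i)"] mult assms
    by (simp add: mult.commute)
  then have "antidiag n * P_bar (am, a0, ap) \<alpha>
      = mat_diag n (\<lambda>i. - ?p' (n - 1 - (n - 1 - i))) * antidiag n"
    by (simp only: antidiag_mat_diag)
  also have "mat_diag n (\<lambda>i. - ?p' (n - 1 - (n - 1 - i))) = - P_mat (ap, - a0, am) \<alpha>"
    by (auto simp: P_mat_def n mat_diag_def)
  finally show "antidiag n * P_bar (am, a0, ap) \<alpha> = - (P_mat (ap, - a0, am) \<alpha> * antidiag n)"
    using P_mat_carrier[of "(ap, - a0, am)" \<alpha>] n by (simp add: uminus_mult_mat[of _ n n _ n])
  have "- ?p (n - 1 - i) * ?p' i = lam \<alpha>" if "i < n" for i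
    using mult[of "n - 1 - i"] that by simp
  then have P_bar': "P_bar (ap, - a0, am) \<alpha> = mat_diag n (\<lambda>i. - ?p (n - 1 - i))"
    using P_bar_eqI[of "(ap, - a0, am)" "\<lambda>i. - ?p (n - 1 - i)"] n by simp
  have "antidiag n * P_mat (am, a0, ap) \<alpha> = mat_diag n (\<lambda>i. ?p (n - 1 - i)) * antidiag n"
    unfolding P_mat_def assms by (rule antidiag_mat_diag)
  also have "mat_diag n (\<lambda>i. ?p (n - 1 - i)) = - P_bar (ap, - a0, am) \<alpha>"
    unfolding P_bar' by (auto simp: mat_diag_def)
  finally show "antidiag n * P_mat (am, a0, ap) \<alpha> = - (P_bar (ap, - a0, am) \<alpha> * antidiag n)"
    using P_bar_carrier[of "(ap, - a0, am)" \<alpha>] n by (simp add: uminus_mult_mat[of _ n n _ n])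
qed

lemma transpose_mat_diag: "transpose_mat (mat_diag n q) = mat_diag n q"
  by (auto simp: mat_diag_def)

lemma transpose_P_mat: "transpose_mat (P_mat a \<alpha>) = P_mat a \<alpha>"
  by (simp add: P_mat_def transpose_mat_diag)

lemma transpose_P_bar: "transpose_mat (P_bar a \<alpha>) = P_bar a \<alpha>"
proof -
  have "P_bar a \<alpha> = mat_diag (asize a) (\<lambda>i. lam \<alpha> div P_entries a \<alpha> ! i)"
    by (rule P_bar_eqI) (use P_entries_dvd_lam in simp)
  then show ?thesis by (simp add: transpose_mat_diag)
qed

theorem corollary5p4:
  fixes n a_minus a_zero a_plus :: nat and \<alpha> :: complex and K :: "complex poly mat"
  assumes "n \<ge> 1"
    and "K \<in> GL n"
    and "a_minus + a_zero + a_plus = n"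
  shows "Uh_dual (mod_alpha \<alpha> (a_minus, int a_zero, a_plus) K)
    \<simeq> mod_alpha \<alpha> (a_plus, - int a_zero, a_minus)
        (- (antidiag n * transpose_mat (GL_inv n K) * antidiag n))"
proof -
  let ?a = "(a_minus, int a_zero, a_plus)" and ?a' = "(a_plus, - int a_zero, a_minus)"
  have n: "asize ?a = n" "asize ?a' = n"
    using assms by (auto simp: asize_def)
  define T where "T = antidiag n"
  define L where "L = GL_inv n K"
  define K' where "K' = - (T * transpose_mat L * T)"
  \<comment> \<open>The inverse of \<open>K'\<close>: transposition preserves inverses,
    \<open>T\<close> is an involution, and the two signs cancel.\<close>
  define L' where "L' = - (T * transpose_mat K * T)"
  define P Q P' Q' where "P = P_mat ?a \<alpha>" and "Q = P_bar ?a \<alpha>"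
    and "P' = P_mat ?a' \<alpha>" and "Q' = P_bar ?a' \<alpha>"
  note K = GL_D[OF assms(2), folded L_def]
  note [simp] = mult_carrier_mat[of _ n n _ n]
  have T [simp]: "T \<in> carrier_mat n n"
    by (simp add: T_def)
  have [simp]: "P \<in> carrier_mat n n" "Q \<in> carrier_mat n n" "P' \<in> carrier_mat n n"
    "Q' \<in> carrier_mat n n"
    using P_mat_carrier[of ?a] P_bar_carrier[of ?a] P_mat_carrier[of ?a'] P_bar_carrier[of ?a']
    unfolding P_def Q_def P'_def Q'_def n by simp_all
  note [simp] = K(1,2)
  have [simp]: "K' \<in> carrier_mat n n" "L' \<in> carrier_mat n n"
    unfolding K'_def L'_def by simp_all
  note neg = uminus_mult_mat[of _ n n _ n]
  note assoc = assoc_mult_mat[of _ n n _ n _ n]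
  have TT: "T * T = 1\<^sub>m n"
    by (simp add: T_def antidiag_mult_antidiag)
  have cancel: "A * (B * X) = X"
    if "A * B = 1\<^sub>m n" "A \<in> carrier_mat n n" "B \<in> carrier_mat n n" "X \<in> carrier_mat n n"
    for A B X :: "complex poly mat"
    using that assoc[of A B X] by simp
  have TT_cancel: "T * (T * X) = X" if "X \<in> carrier_mat n n" for X
    using cancel[OF TT T T that] .
  have LK: "transpose_mat L * transpose_mat K = 1\<^sub>m n" "transpose_mat K * transpose_mat L = 1\<^sub>m n"
    using K by (simp_all flip: transpose_mult[of _ n n _ n])
  have LK_cancel: "transpose_mat L * (transpose_mat K * X) = X"
    "transpose_mat K * (transpose_mat L * X) = X" if "X \<in> carrier_mat n n" for X
    using cancel[OF LK(1)] cancel[OF LK(2)] that by simp_all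
  have TK': "T * K' = - (transpose_mat L * T)" and TL': "T * L' = - (transpose_mat K * T)"
    by (simp_all add: K'_def L'_def assoc TT_cancel neg)
  have "L' * K' = 1\<^sub>m n" "K' * L' = 1\<^sub>m n"
    by (simp_all add: K'_def L'_def assoc TT_cancel LK_cancel TT neg)
  then have K'_GL: "K' \<in> GL n" and L'_eq: "GL_inv n K' = L'"
    using GL_I[of K' n L'] by simp_all
  have PT: "transpose_mat P = P" and QT: "transpose_mat Q = Q"
    by (simp_all add: P_def Q_def transpose_P_mat transpose_P_bar)
  \<comment> \<open>The reversal lemma is applied to \<open>?a'\<close>; reversing it leads back to
    \<open>?a\<close> because the double negation of \<open>a_zero\<close> disappears.\<close>
  have TP': "T * P' = - (Q * T)" and TQ': "T * Q' = - (P * T)"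
    using P_bar_reversed[OF n(2), of \<alpha>] by (simp_all add: T_def P_def Q_def P'_def Q'_def)
  \<comment> \<open>In this product and the next, moving \<open>T\<close> to the right past each
    factor produces one sign, and the two signs cancel.\<close>
  have E': "T * (L' * Q') = transpose_mat K * P * T"
    by (simp add: assoc[symmetric, of T L' Q'] TL' neg assoc TQ')
  have F': "T * (P' * K') = Q * transpose_mat L * T"
    by (simp add: assoc[symmetric, of T P' K'] TP' neg assoc TK')
  have "Uh_dual (mod_EF n (map_mat sigma (L * Q)) (P * K))
      \<simeq> mod_EF n (map_mat sigma (L' * Q')) (P' * K')"
  \<comment> \<open>The change of coordinates is \<open>T\<close>, its own inverse and constant in
    the variable.\<close>
  proof (rule Uh_dual_mod_EF_iso[where S = T and S' = T])
    show "map_mat sigma (L' * Q') * map_mat sigma (P' * K')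
        = P' * K' * map_mat sigma_inv (map_mat sigma (L' * Q')) + [:0, 2:] \<cdot>\<^sub>m 1\<^sub>m n"
      using mod_alpha_relation[of K' ?a' \<alpha>] K'_GL unfolding n L'_eq P'_def Q'_def by simp
    show sT: "map_mat sigma T = T"
      by (simp add: T_def sigma_antidiag)
    \<comment> \<open>The condition on \<open>e\<close> is the unshifted identity \<open>E'\<close>
      with \<open>sigma\<close> applied to both sides.\<close>
    have "map_mat sigma (T * (L' * Q')) = map_mat sigma (transpose_mat (P * K) * T)"
      by (simp add: E' transpose_mult[of _ n n _ n] PT)
    then show "T * map_mat sigma (L' * Q') = transpose_mat (map_mat sigma (P * K)) * T"
      by (simp add: sigma.mat_hom_mult[of T n n "L' * Q'" n] sT
          sigma.mat_hom_mult[of "transpose_mat (P * K)" n n T n] map_mat_transpose)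
    show "T * (P' * K') = transpose_mat (map_mat sigma_inv (map_mat sigma (L * Q))) * T"
      by (simp add: F' transpose_mult[of _ n n _ n] QT)
  qed (auto simp: TT)
  then show ?thesis
    unfolding mod_alpha_def n T_def[symmetric] L_def[symmetric] K'_def[symmetric] L'_eq
      P_def[symmetric] Q_def[symmetric] P'_def[symmetric] Q'_def[symmetric] .
qed

end
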